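(* The bar visibility numbers of the transitive tournaments on $11$, $12$ and $17$ vertices are $b(T_{11})=b(T_{12})=3$ and $b(T_{17})=4$.
   Context: Digraphs are finite, without loops or multiple arcs. A bar is a horizontal line segment of positive length in the plane; bars do not overlap (bars at the same height may at most share an endpoint). A channel is a vertical strip of positive width. One bar sees another bar above it if there is an unblocked channel between them, i.e. a vertical strip of positive width meeting both bars such that no other bar meets the part of the strip between the two. A $t$-bar visibility representation of a digraph $G$ assigns each vertex at most $t$ bars in the plane so that, for distinct vertices $x,y$, there is an arc $xy$ (from $x$ to $y$) in $G$ if and only if some bar for $x$ sees some bar for $y$ above it along an unblocked channel (visibilities between two bars of the same vertex are ignored). The bar visibility number $b(G)$ is the least $t$ such that $G$ has a $t$-bar visibility representation. The transitive tournament $T_n$ is the digraph on $v_1,\ldots,v_n$ with arc set $\{v_iv_j : i<j\}$. *)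

theory Defs
  imports Complex_Main "Graph_Theory.Digraph"
begin

text \<open>
  The bar \<open>Bar h l r\<close> is the horizontal segment from \<open>(l, h)\<close> to \<open>(r, h)\<close>; the datatype
  itself does not enforce \<open>l < r\<close>, which is required separately by \<open>proper_bar\<close>.
\<close>

datatype bar = Bar (bar_height: real) (bar_left: real) (bar_right: real)

definition proper_bar :: "bar \<Rightarrow> bool" where
  "proper_bar a \<longleftrightarrow> bar_left a < bar_right a"

definition bar_points :: "bar \<Rightarrow> (real \<times> real) set" where
  "bar_points a = {bar_left a..bar_right a} \<times> {bar_height a}"

text \<open>Bars at the same height that merely share an endpoint do not overlap.\<close>

definition bars_overlap :: "bar \<Rightarrow> bar \<Rightarrow> bool" where
  "bars_overlap a b \<longleftrightarrow> bar_height a = bar_height b \<and>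
     {bar_left a<..<bar_right a} \<inter> {bar_left b<..<bar_right b} \<noteq> {}"

text \<open>
  \<open>bar_sees B a b\<close>: among the bars \<open>B\<close>, bar \<open>a\<close> sees bar \<open>b\<close> above it. The channel is the strip
  over \<open>{p<..<q}\<close>, which runs from \<open>a\<close> to \<open>b\<close> across its entire width. Taking it open
  or closed makes no difference, since a channel may always be narrowed.
\<close>

definition bar_sees :: "bar set \<Rightarrow> bar \<Rightarrow> bar \<Rightarrow> bool" where
  "bar_sees B a b \<longleftrightarrow> bar_height a < bar_height b \<and>
     (\<exists>p q. p < q \<and>
        {p<..<q} \<subseteq> {bar_left a..bar_right a} \<and>
        {p<..<q} \<subseteq> {bar_left b..bar_right b} \<and>
        (\<forall>c \<in> B - {a, b}.
           bar_points c \<inter> ({p<..<q} \<times> {bar_height a..bar_height b}) = {}))"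

text \<open>
  In the non-overlap condition the pairs \<open>(x, a)\<close> and \<open>(y, b)\<close> are compared, so that one and the
  same segment cannot be assigned to two different vertices. The bars of every vertex,
  including \<open>x\<close> and \<open>y\<close> themselves, can block a channel.
\<close>

definition bar_visibility_rep ::
    "('v, 'e) pre_digraph \<Rightarrow> nat \<Rightarrow> ('v \<Rightarrow> bar set) \<Rightarrow> bool" where
  "bar_visibility_rep G t f \<longleftrightarrow>
     (\<forall>x \<in> verts G. finite (f x) \<and> card (f x) \<le> t \<and> (\<forall>a \<in> f x. proper_bar a)) \<and>
     (\<forall>x \<in> verts G. \<forall>y \<in> verts G. \<forall>a \<in> f x. \<forall>b \<in> f y.
        (x, a) \<noteq> (y, b) \<longrightarrow> \<not> bars_overlap a b) \<and>
     (\<forall>x \<in> verts G. \<forall>y \<in> verts G. x \<noteq> y \<longrightarrow>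
        (x \<rightarrow>\<^bsub>G\<^esub> y \<longleftrightarrow> (\<exists>a \<in> f x. \<exists>b \<in> f y. bar_sees (\<Union>v \<in> verts G. f v) a b)))"

definition bar_visibility_number :: "('v, 'e) pre_digraph \<Rightarrow> nat" where
  "bar_visibility_number G = (LEAST t. \<exists>f. bar_visibility_rep G t f)"

definition transitive_tournament :: "nat \<Rightarrow> (nat, nat \<times> nat) pre_digraph" where
  "transitive_tournament n =
     \<lparr> verts = {1..n}, arcs = {(i, j). i \<in> {1..n} \<and> j \<in> {1..n} \<and> i < j},
       tail = fst, head = snd \<rparr>"

lemma digraph_transitive_tournament: "digraph (transitive_tournament n)"
proof
  show "finite (arcs (transitive_tournament n))"
    by (rule finite_subset[of _ "{1..n} \<times> {1..n}"]) (auto simp: transitive_tournament_def)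
qed (auto simp: transitive_tournament_def arc_to_ends_def)

lemma transitive_tournament_dominates_iff:
  "i \<rightarrow>\<^bsub>transitive_tournament n\<^esub> j \<longleftrightarrow> i \<in> {1..n} \<and> j \<in> {1..n} \<and> i < j"
  by (auto simp: transitive_tournament_def arcs_ends_def arc_to_ends_def)

end

theory Submission
  imports Defs
begin

text \<open>
  Lower bound: sweep a vertical line from left to right. On every line the labels of the bars
  are weakly increasing from bottom to top, so \<open>v\<^sub>1\<close> and \<open>v\<^sub>n\<close> only occur at the two ends, and all
  their bars can be replaced by one very long bottom bar and one very long top bar without losing
  a visibility. The arc \<open>v\<^sub>1v\<^sub>n\<close> is then visible at once. Every other arc first becomes visible
  when one of the remaining at most \<open>t(n - 2)\<close> bars begins (it may create one arc downwards and one
  upwards) or ends (it may create one arc, between its two neighbours); the last bar to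
  end creates only \<open>v\<^sub>1v\<^sub>n\<close> again. Hence \<open>n(n - 1)/2 \<le> 3t(n - 2)\<close>.

  Upper bound: explicit layouts in which every bar of \<open>v\<^sub>i\<close> has height \<open>i\<close>, so that only the
  presence of all visibilities has to be checked.
\<close>

subsection \<open>Sweeping a line across labelled bars\<close>

locale sweep =
  fixes S :: "'b set" and l r h :: "'b \<Rightarrow> real" and lab :: "'b \<Rightarrow> nat"
  assumes fin: "finite S"
begin

text \<open>The interval is half-open so that of two bars abutting end to end only one is alive at
  the common endpoint, and so that the set of alive bars stays constant from each endpoint until
  just before the next.\<close>

definition alive :: "real \<Rightarrow> 'b \<Rightarrow> bool" where
  "alive x b \<longleftrightarrow> b \<in> S \<and> l b \<le> x \<and> x < r b"

definition adj :: "real \<Rightarrow> 'b \<Rightarrow> 'b \<Rightarrow> bool" where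
  "adj x a b \<longleftrightarrow> alive x a \<and> alive x b \<and> h a < h b \<and>
     \<not> (\<exists>c. alive x c \<and> h a < h c \<and> h c < h b)"

definition visible :: "nat \<Rightarrow> nat \<Rightarrow> real \<Rightarrow> bool" where
  "visible i j x \<longleftrightarrow> (\<exists>a b. adj x a b \<and> lab a = i \<and> lab b = j)"

lemma finite_alive: "finite {c. alive x c \<and> P c}"
  by (rule finite_subset[OF _ fin]) (auto simp: alive_def)

text \<open>Induction on the number of alive bars strictly between \<open>a\<close> and
  \<open>b\<close>: either there is none and the bars are adjacent, or an intermediate bar splits
  the claim into two smaller ones.\<close>

lemma lab_mono_if_adj:
  assumes "\<And>a b. adj x a b \<Longrightarrow> lab a \<le> lab b" "alive x a" "alive x b" "h a < h b"
  shows "lab a \<le> lab b"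
  using assms(2-)
proof (induction "card {c. alive x c \<and> h a < h c \<and> h c < h b}" arbitrary: a b rule: less_induct)
  case less
  show ?case
  proof (cases "adj x a b")
    case True
    then show ?thesis by (rule assms(1))
  next
    case False
    then obtain c where c: "alive x c" "h a < h c" "h c < h b"
      using less.prems by (auto simp: adj_def)
    have "lab a \<le> lab c"
      by (rule less.hyps[OF psubset_card_mono[OF finite_alive]]) (use c less.prems in auto)
    also have "lab c \<le> lab b"
      by (rule less.hyps[OF psubset_card_mono[OF finite_alive]]) (use c less.prems in auto)
    finally show ?thesis .
  qed
qed

end

section \<open>Sorted sweeps and the first appearance of an arc\<close>

locale sorted_sweep = sweep S l r h lab
  for S :: "'b set" and l r h :: "'b \<Rightarrow> real" and lab :: "'b \<Rightarrow> nat" +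
  assumes height_inj: "alive x a \<Longrightarrow> alive x b \<Longrightarrow> h a = h b \<Longrightarrow> a = b"
    and lab_mono: "alive x a \<Longrightarrow> alive x b \<Longrightarrow> h a < h b \<Longrightarrow> lab a \<le> lab b"
begin

definition endpoints :: "real set" where
  "endpoints = l ` S \<union> r ` S"

lemma finite_endpoints: "finite endpoints"
  unfolding endpoints_def using fin by simp

text \<open>No bar begins or ends after the greatest endpoint up to \<open>x\<close> and before or
  at \<open>x\<close> itself, so both lines meet the same bars. Finitely many lines therefore
  represent all states.\<close>

lemma visible_at_endpoint:
  assumes "visible i j x"
  obtains y where "y \<in> endpoints" "visible i j y"
proof -
  define Y where "Y = {e \<in> endpoints. e \<le> x}"
  have fY: "finite Y" unfolding Y_def using finite_endpoints by simp
  obtain a b where ab: "adj x a b" "lab a = i" "lab b = j"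
    using assms by (auto simp: visible_def)
  then have "l a \<in> Y" by (auto simp: adj_def alive_def Y_def endpoints_def)
  then have y: "Max Y \<in> Y" using fY by (metis Max_in empty_iff)
  have "e \<le> Max Y \<longleftrightarrow> e \<le> x" if "e \<in> endpoints" for e
    using that y Max_ge[OF fY, of e] by (auto simp: Y_def)
  then have "alive (Max Y) = alive x"
    unfolding alive_def endpoints_def not_le[symmetric] by blast
  then have "visible i j (Max Y)"
    using ab unfolding visible_def adj_def by auto
  with y show thesis using that unfolding Y_def by blast
qed

text \<open>At the least endpoint where the arc is visible, either one of its two bars begins, or
  some bar separated them just before and ends there. A separator with label strictly between
  \<open>i\<close> and \<open>j\<close> exists: if all separators were labelled \<open>i\<close> or
  \<open>j\<close>, the arc would have been visible earlier.\<close>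

lemma first_visible:
  assumes "visible i j x" "i < j"
  obtains y a b where "adj y a b" "lab a = i" "lab b = j"
    "y = l a \<or> y = l b \<or> (\<exists>c \<in> S. y = r c \<and> h a < h c \<and> h c < h b \<and> i < lab c \<and> lab c < j)"
proof -
  define V where "V = {e \<in> endpoints. visible i j e}"
  have fV: "finite V" unfolding V_def using finite_endpoints by simp
  define z where "z = Min V"
  have "V \<noteq> {}" using visible_at_endpoint[OF assms(1)] by (auto simp: V_def)
  then have "z \<in> V" and z_le: "\<And>e. e \<in> V \<Longrightarrow> z \<le> e"
    unfolding z_def using fV by auto
  then obtain a b where ab: "adj z a b" "lab a = i" "lab b = j"
    by (auto simp: V_def visible_def)
  have "\<exists>c \<in> S. z = r c \<and> h a < h c \<and> h c < h b \<and> i < lab c \<and> lab c < j"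
    if "z \<noteq> l a" "z \<noteq> l b"
  proof -
    \<comment> \<open>\<open>Max Y\<close> is the last endpoint before \<open>z\<close>; its line
      shows the state immediately to the left of \<open>z\<close>.\<close>
    define Y where "Y = {e \<in> endpoints. e < z}"
    have fY: "finite Y" unfolding Y_def using finite_endpoints by simp
    have la: "l a < z" "l b < z" using ab that by (auto simp: adj_def alive_def)
    then have "l a \<in> Y" using ab by (auto simp: adj_def alive_def Y_def endpoints_def)
    then have y: "Max Y \<in> Y" using fY by (metis Max_in empty_iff)
    have alive_y: "alive (Max Y) d \<longleftrightarrow> d \<in> S \<and> l d < z \<and> z \<le> r d" for d
    proof -
      have "e \<le> Max Y \<longleftrightarrow> e < z" if "e \<in> endpoints" for e
        using that y Max_ge[OF fY, of e] by (auto simp: Y_def)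
      then show ?thesis unfolding alive_def endpoints_def
        by (metis UnI1 UnI2 imageI not_le)
    qed
    have a: "alive (Max Y) a" and b: "alive (Max Y) b"
      unfolding alive_y using ab la by (auto simp: adj_def alive_def)
    have nv: "\<not> visible i j (Max Y)"
      using y z_le by (force simp: V_def Y_def)
    have "\<exists>c. alive (Max Y) c \<and> h a < h c \<and> h c < h b \<and> lab c \<noteq> i \<and> lab c \<noteq> j"
    proof (rule ccontr)
      assume no: "\<not> ?thesis"
      \<comment> \<open>The earlier visibility comes from the highest bar \<open>a'\<close> labelled
        \<open>i\<close> from \<open>a\<close> upwards and below \<open>b\<close>, together with the
        bar \<open>b'\<close> directly above it, which can then only be labelled
        \<open>j\<close>.\<close>
      define A where "A = {c. alive (Max Y) c \<and> (lab c = i \<and> h a \<le> h c \<and> h c < h b)}"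
      have fA: "finite A" unfolding A_def by (rule finite_alive)
      have aA: "a \<in> A" using a ab by (auto simp: A_def adj_def)
      obtain a' where a': "a' \<in> A" "\<And>c. c \<in> A \<Longrightarrow> h c \<le> h a'"
        using ex_is_arg_min_if_finite[of A "\<lambda>c. - h c"] fA aA
        by (auto simp: is_arg_min_linorder)
      define B where "B = {c. alive (Max Y) c \<and> (h a' < h c \<and> h c \<le> h b)}"
      have fB: "finite B" unfolding B_def by (rule finite_alive)
      have bB: "b \<in> B" using a' b by (auto simp: A_def B_def)
      obtain b' where b': "b' \<in> B" "\<And>c. c \<in> B \<Longrightarrow> h b' \<le> h c"
        using ex_is_arg_min_if_finite[of B h] fB bB
        by (auto simp: is_arg_min_linorder)
      have "adj (Max Y) a' b'"
        using a' b' by (force simp: adj_def A_def B_def)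
      moreover have "lab b' = j"
      proof (cases "h b' = h b")
        case True
        then have "b' = b" using height_inj b' b by (auto simp: B_def)
        then show ?thesis using ab by simp
      next
        case False
        then have "alive (Max Y) b'" "h a < h b'" "h b' < h b" "h a' < h b'"
          using a' b' by (auto simp: A_def B_def)
        moreover from this have "lab b' \<noteq> i"
          using a'(2)[of b'] by (auto simp: A_def)
        ultimately show ?thesis using no by blast
      qed
      ultimately show False using nv a' by (auto simp: visible_def A_def)
    qed
    then obtain c where c: "alive (Max Y) c" "h a < h c" "h c < h b" "lab c \<noteq> i" "lab c \<noteq> j"
      by blast
    have "lab a \<le> lab c" "lab c \<le> lab b" using lab_mono a b c by blast+
    moreover have "\<not> alive z c" using ab c by (auto simp: adj_def)
    moreover have "c \<in> S" "l c < z" "z \<le> r c" using c(1) by (simp_all add: alive_y)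
    ultimately show ?thesis using c ab by (force simp: alive_def)
  qed
  then show thesis using that ab by blast
qed

lemma adj_straddle_unique:
  assumes "adj x a b" "adj x a' b'" "h a < y" "y < h b" "h a' < y" "y < h b'"
  shows "a = a' \<and> b = b'"
  using assms height_inj unfolding adj_def
  by (smt (verit))

lemma adj_upper_unique: "adj x a b \<Longrightarrow> adj x a b' \<Longrightarrow> b = b'"
  using height_inj unfolding adj_def by (metis linorder_neqE)

lemma adj_lower_unique: "adj x a b \<Longrightarrow> adj x a' b \<Longrightarrow> a = a'"
  using height_inj unfolding adj_def by (metis linorder_neqE)

section \<open>Counting arcs by the events that create them\<close>

text \<open>
  The event \<open>(m, k)\<close> is the one responsible for the arc \<open>e\<close>: for \<open>k = 0\<close> or \<open>k = 1\<close> bar \<open>m\<close>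
  begins as the lower or upper end of \<open>e\<close>, for \<open>k = 2\<close> bar \<open>m\<close> ends between the ends of \<open>e\<close>.
\<close>

definition creates :: "'b \<times> nat \<Rightarrow> nat \<times> nat \<Rightarrow> bool" where
  "creates = (\<lambda>(m, k) e. \<exists>a b x. adj x a b \<and> e = (lab a, lab b) \<and>
     (k = 0 \<and> m = a \<and> x = l a \<or> k = 1 \<and> m = b \<and> x = l b \<or>
      k = 2 \<and> x = r m \<and> h a < h m \<and> h m < h b))"

text \<open>An event fixes the line and, on it, the lower bar, the upper bar, or a height strictly
  between the two. Any one of these determines an adjacent pair.\<close>

lemma creates_unique:
  assumes "creates ev e" "creates ev e'"
  shows "e = e'"
proof -
  obtain m k where ev: "ev = (m, k)" by (cases ev)
  from assms(1) obtain a b x where ab: "adj x a b" "e = (lab a, lab b)"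
    "k = 0 \<and> m = a \<and> x = l a \<or> k = 1 \<and> m = b \<and> x = l b \<or>
      k = 2 \<and> x = r m \<and> h a < h m \<and> h m < h b"
    unfolding creates_def ev by auto
  from assms(2) obtain a' b' x' where ab': "adj x' a' b'" "e' = (lab a', lab b')"
    "k = 0 \<and> m = a' \<and> x' = l a' \<or> k = 1 \<and> m = b' \<and> x' = l b' \<or>
      k = 2 \<and> x' = r m \<and> h a' < h m \<and> h m < h b'"
    unfolding creates_def ev by auto
  have "a = a' \<and> b = b'"
    using ab(3) ab'(3)
    by (elim disjE; clarsimp)
      (use ab(1) ab'(1) adj_upper_unique adj_lower_unique adj_straddle_unique in blast)+
  then show ?thesis using ab(2) ab'(2) by simp
qed

lemma arcs_le_three_times_bars:
  assumes "s \<in> S" "t \<in> S" "l s = L" "l t = L" "r s = R" "r t = R"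
    and M: "M = S - {s, t}"
    and inner: "\<And>b. b \<in> M \<Longrightarrow> L < l b \<and> r b < R \<and> 1 < lab b \<and> lab b < n"
    and lab_ends: "lab s = 1" "lab t = n"
    and vis: "\<And>i j. 1 \<le> i \<Longrightarrow> i < j \<Longrightarrow> j \<le> n \<Longrightarrow> (i, j) \<noteq> (1, n) \<Longrightarrow> \<exists>x. visible i j x"
    and n: "3 \<le> n"
  shows "n * (n - 1) div 2 \<le> 3 * card M"
proof -
  \<comment> \<open>Pairs in \<open>E\<close> carry the larger index first, whence
    \<open>(n, 1)\<close> and \<open>prod.swap\<close> further down.\<close>
  define E where "E = (SIGMA j:{1..n}. {1..<j})"
  have "card E = (\<Sum>j=1..n. j - 1)"
    unfolding E_def by simp
  also have "2 * \<dots> = n * (n - 1)"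
  proof (induction n)
    case (Suc n)
    then show ?case by (cases n) auto
  qed simp
  finally have cE: "card E = n * (n - 1) div 2" by simp
  have fM: "finite M" using fin M by simp
  \<comment> \<open>The last conjunct says that some inner bar outlives an event of kind 2; it is
    what excludes the end of the last bar.\<close>
  have created: "\<exists>ev \<in> M \<times> {0, 1, 2}. creates ev (i, j) \<and> (snd ev = 2 \<longrightarrow> (\<exists>b \<in> M. r (fst ev) < r b))"
    if "1 \<le> i" "i < j" "j \<le> n" "(i, j) \<noteq> (1, n)" for i j
  proof -
    have "\<exists>x. visible i j x" using vis that by blast
    then obtain x where "visible i j x" by blast
    then obtain y a b where ab: "adj y a b" "lab a = i" "lab b = j"
      and y: "y = l a \<or> y = l b \<or>
        (\<exists>c \<in> S. y = r c \<and> h a < h c \<and> h c < h b \<and> i < lab c \<and> lab c < j)"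
      using first_visible \<open>i < j\<close> by metis
    have aS: "a \<in> S" "b \<in> S" "l a \<le> y" "l b \<le> y" "y < r a" "y < r b"
      using ab by (auto simp: adj_def alive_def)
    \<comment> \<open>As \<open>(i, j)\<close> is not \<open>(1, n)\<close>, one of the two bars is
      inner and begins after \<open>L\<close>. Hence \<open>y\<close> lies to the right of
      \<open>L\<close>, and neither long bar can begin there.\<close>
    have "a \<in> M \<or> b \<in> M"
      using aS ab that lab_ends M by auto
    then have yL: "L < y" using inner aS by force
    from y show ?thesis
    proof (elim disjE bexE conjE)
      assume "y = l a"
      then have "a \<in> M" using yL aS M assms(3,4) by auto
      then show ?thesis using ab \<open>y = l a\<close>
        by (intro bexI[of _ "(a, 0)"]) (auto simp: creates_def)
    next
      assume "y = l b"
      then have "b \<in> M" using yL aS M assms(3,4) by auto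
      then show ?thesis using ab \<open>y = l b\<close>
        by (intro bexI[of _ "(b, 1)"]) (auto simp: creates_def)
    next
      fix c assume c: "c \<in> S" "y = r c" "h a < h c" "h c < h b" "i < lab c" "lab c < j"
      then have "c \<in> M" using M that lab_ends by auto
      \<comment> \<open>Whichever of \<open>a\<close> and \<open>b\<close> is inner is still alive
        at \<open>r c\<close>, so it ends strictly later.\<close>
      moreover have "\<exists>d \<in> M. r c < r d"
        using aS c \<open>a \<in> M \<or> b \<in> M\<close> by auto
      ultimately show ?thesis using ab c
        by (intro bexI[of _ "(c, 2)"]) (auto simp: creates_def)
    qed
  qed
  have "M \<noteq> {}" using created[of 1 2] n by auto
  then obtain m where m: "m \<in> M" "\<And>b. b \<in> M \<Longrightarrow> r b \<le> r m"
    using ex_is_arg_min_if_finite[of M "\<lambda>b. - r b"] fM by (auto simp: is_arg_min_linorder)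
  define Ev where "Ev = M \<times> {0, 1, 2::nat} - {(m, 2)}"
  have "\<exists>ev \<in> Ev. creates ev (prod.swap e)" if "e \<in> E - {(n, 1)}" for e
    using created[of "snd e" "fst e"] that m(2)
    by (cases e) (fastforce simp: E_def Ev_def not_le[symmetric])
  then obtain g where g: "\<And>e. e \<in> E - {(n, 1)} \<Longrightarrow> g e \<in> Ev \<and> creates (g e) (prod.swap e)"
    by metis
  have "inj_on g (E - {(n, 1)})"
    by (rule inj_onI) (metis g creates_unique swap_swap)
  then have "card (E - {(n, 1)}) \<le> card Ev"
  proof (rule card_inj_on_le)
    show "g ` (E - {(n, 1)}) \<subseteq> Ev" using g by blast
    show "finite Ev" using fM by (simp add: Ev_def)
  qed
  moreover have "card (E - {(n, 1)}) = card E - 1"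
    using n by (subst card_Diff_singleton) (auto simp: E_def)
  moreover have "card Ev = 3 * card M - 1"
    unfolding Ev_def using m(1) by (subst card_Diff_singleton) (auto simp: card_cartesian_product)
  moreover have "card M > 0" using fM \<open>M \<noteq> {}\<close> by (simp add: card_gt_0_iff)
  ultimately show ?thesis using cE by linarith
qed

end

subsection \<open>The lower bound\<close>

locale tournament_rep =
  fixes n t :: nat and f :: "nat \<Rightarrow> bar set"
  assumes rep: "bar_visibility_rep (transitive_tournament n) t f"
begin

lemma verts [simp]: "verts (transitive_tournament n) = {1..n}"
  by (simp add: transitive_tournament_def)

lemma finite_bars: "x \<in> {1..n} \<Longrightarrow> finite (f x)"
  and card_bars: "x \<in> {1..n} \<Longrightarrow> card (f x) \<le> t"
  using rep by (auto simp: bar_visibility_rep_def)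

lemma no_overlap:
  "x \<in> {1..n} \<Longrightarrow> y \<in> {1..n} \<Longrightarrow> a \<in> f x \<Longrightarrow> b \<in> f y \<Longrightarrow> (x, a) \<noteq> (y, b) \<Longrightarrow> \<not> bars_overlap a b"
  using rep unfolding bar_visibility_rep_def verts by blast

lemma sees_iff:
  "x \<in> {1..n} \<Longrightarrow> y \<in> {1..n} \<Longrightarrow> x \<noteq> y \<Longrightarrow>
    x < y \<longleftrightarrow> (\<exists>a \<in> f x. \<exists>b \<in> f y. bar_sees (\<Union>v \<in> {1..n}. f v) a b)"
  using rep unfolding bar_visibility_rep_def verts transitive_tournament_dominates_iff by blast

text \<open>Tagging each bar with its vertex turns the label into the first projection and makes the
  number of bars a sum over the vertices.\<close>

definition labelled_bars :: "(nat \<times> bar) set" where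
  "labelled_bars = Sigma {1..n} f"

lemma labelled_bars_iff: "p \<in> labelled_bars \<longleftrightarrow> fst p \<in> {1..n} \<and> snd p \<in> f (fst p)"
  by (cases p) (simp add: labelled_bars_def)

sublocale bars: sweep labelled_bars
  "\<lambda>p. bar_left (snd p)" "\<lambda>p. bar_right (snd p)" "\<lambda>p. bar_height (snd p)" fst
  by unfold_locales (use finite_bars in \<open>auto simp: labelled_bars_def\<close>)

text \<open>Two bars alive at \<open>x\<close> both extend to the right of \<open>x\<close>, so at
  equal height their interiors would meet, for instance halfway between \<open>x\<close> and the
  nearer right end.\<close>

lemma alive_height_inj:
  assumes "bars.alive x p" "bars.alive x q" "bar_height (snd p) = bar_height (snd q)"
  shows "p = q"
proof (rule ccontr)
  assume "p \<noteq> q"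
  define y where "y = (x + min (bar_right (snd p)) (bar_right (snd q))) / 2"
  have "y \<in> {bar_left (snd p)<..<bar_right (snd p)} \<inter> {bar_left (snd q)<..<bar_right (snd q)}"
    using assms(1,2) unfolding y_def bars.alive_def by (auto simp: min_def field_simps)
  then have "bars_overlap (snd p) (snd q)"
    using assms(3) unfolding bars_overlap_def by blast
  then show False
    using no_overlap[of "fst p" "fst q" "snd p" "snd q"] assms \<open>p \<noteq> q\<close>
    by (auto simp: bars.alive_def labelled_bars_iff)
qed

text \<open>The channel runs from \<open>x\<close> to the next endpoint \<open>y\<close>. A bar
  meeting the strip in between cannot begin inside it, so it is already alive at \<open>x\<close>,
  where adjacency keeps it from lying between the two bars.\<close>

lemma sees_if_adj:
  assumes "bars.adj x p q"
  shows "bar_sees (\<Union>v \<in> {1..n}. f v) (snd p) (snd q)"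
proof -
  define Y where "Y = {e \<in> (\<lambda>p. bar_left (snd p)) ` labelled_bars \<union>
    (\<lambda>p. bar_right (snd p)) ` labelled_bars. x < e}"
  define y where "y = Min Y"
  have fY: "finite Y" unfolding Y_def using bars.fin by simp
  have pq: "bars.alive x p" "bars.alive x q" "bar_height (snd p) < bar_height (snd q)"
    using assms by (auto simp: bars.adj_def)
  then have rY: "bar_right (snd p) \<in> Y" "bar_right (snd q) \<in> Y"
    by (auto simp: Y_def bars.alive_def)
  then have "y \<in> Y" using Min_in[OF fY] unfolding y_def by blast
  then have xy: "x < y" by (simp add: Y_def)
  have y_le: "y \<le> e" if "e \<in> Y" for e unfolding y_def using fY that by simp
  have "bar_points c \<inter> ({x<..<y} \<times> {bar_height (snd p)..bar_height (snd q)}) = {}"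
    if c: "c \<in> (\<Union>v \<in> {1..n}. f v) - {snd p, snd q}" for c
  proof (rule ccontr)
    assume "\<not> ?thesis"
    then obtain z where z: "x < z" "z < y" "bar_left c \<le> z" "z \<le> bar_right c"
      "bar_height (snd p) \<le> bar_height c" "bar_height c \<le> bar_height (snd q)"
      by (auto simp: bar_points_def)
    obtain v where v: "v \<in> {1..n}" "c \<in> f v" using c by blast
    have "bar_left c \<le> x"
    proof (rule ccontr)
      assume "\<not> ?thesis"
      moreover have "bar_left (snd (v, c)) \<in> (\<lambda>p. bar_left (snd p)) ` labelled_bars"
        by (rule imageI) (use v in \<open>simp add: labelled_bars_iff\<close>)
      ultimately have "bar_left c \<in> Y" by (simp add: Y_def)
      then show False using y_le z by fastforce
    qed
    then have alive: "bars.alive x (v, c)" using v z by (auto simp: bars.alive_def labelled_bars_iff)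
    have "(v, c) \<noteq> p" "(v, c) \<noteq> q" using c by auto
    then have "bar_height (snd p) < bar_height (snd (v, c))" "bar_height (snd (v, c)) < bar_height (snd q)"
      using alive_height_inj[OF alive pq(1)] alive_height_inj[OF alive pq(2)] z by (auto simp: less_le)
    then show False using assms alive unfolding bars.adj_def by blast
  qed
  moreover have "{x<..<y} \<subseteq> {bar_left (snd p)..bar_right (snd p)}"
    "{x<..<y} \<subseteq> {bar_left (snd q)..bar_right (snd q)}"
    using pq rY[THEN y_le] by (auto simp: bars.alive_def)
  ultimately show ?thesis
    unfolding bar_sees_def using pq(3) xy by blast
qed

text \<open>Adjacent bars of different vertices see each other, and arcs only lead to larger
  indices; so labels do not decrease between neighbours, and hence along the whole line.\<close>

sublocale bars: sorted_sweep labelled_bars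
  "\<lambda>p. bar_left (snd p)" "\<lambda>p. bar_right (snd p)" "\<lambda>p. bar_height (snd p)" fst
proof unfold_locales
  fix x p q
  assume *: "bars.alive x p" "bars.alive x q" "bar_height (snd p) < bar_height (snd q)"
  have "fst a \<le> fst b" if "bars.adj x a b" for a b
  proof -
    have "fst a \<in> {1..n}" "fst b \<in> {1..n}" "snd a \<in> f (fst a)" "snd b \<in> f (fst b)"
      using that by (auto simp: bars.adj_def bars.alive_def labelled_bars_iff)
    then show ?thesis using sees_if_adj[OF that] sees_iff[of "fst a" "fst b"] by force
  qed
  then show "fst p \<le> fst q" using bars.lab_mono_if_adj * by blast
qed (rule alive_height_inj)

text \<open>The left edge \<open>p\<close> of a channel is a line on which the two bars are
  adjacent: any bar alive at \<open>p\<close> reaches into the channel.\<close>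

lemma visible_bars:
  assumes "1 \<le> i" "i < j" "j \<le> n"
  obtains x where "bars.visible i j x"
proof -
  obtain a b where ab: "a \<in> f i" "b \<in> f j" and sees: "bar_sees (\<Union>v \<in> {1..n}. f v) a b"
    using sees_iff[of i j] assms by auto
  from sees obtain p q where h: "bar_height a < bar_height b" and pq: "p < q"
    "{p<..<q} \<subseteq> {bar_left a..bar_right a}" "{p<..<q} \<subseteq> {bar_left b..bar_right b}"
    and free: "\<And>c. c \<in> (\<Union>v \<in> {1..n}. f v) - {a, b} \<Longrightarrow>
      bar_points c \<inter> ({p<..<q} \<times> {bar_height a..bar_height b}) = {}"
    unfolding bar_sees_def by blast
  have alive: "bars.alive p (i, a)" "bars.alive p (j, b)"
    using pq ab assms
    by (auto simp: bars.alive_def labelled_bars_iff greaterThanLessThan_subseteq_atLeastAtMost_iff)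
  have "bars.adj p (i, a) (j, b)"
    unfolding bars.adj_def
  proof (intro conjI notI alive; (elim exE conjE)?)
    show "bar_height (snd (i, a)) < bar_height (snd (j, b))" using h by simp
    fix c assume c: "bars.alive p c" "bar_height (snd (i, a)) < bar_height (snd c)"
      "bar_height (snd c) < bar_height (snd (j, b))"
    have "snd c \<in> (\<Union>v \<in> {1..n}. f v) - {a, b}" using c by (auto simp: bars.alive_def labelled_bars_iff)
    \<comment> \<open>The witness is a point of \<open>c\<close> to the right of \<open>p\<close>
      but before both \<open>q\<close> and the right end of \<open>c\<close>.\<close>
    from free[OF this]
    have "((p + min q (bar_right (snd c))) / 2, bar_height (snd c)) \<notin>
        bar_points (snd c) \<inter> ({p<..<q} \<times> {bar_height a..bar_height b})" by simp
    then show False using c pq(1) by (auto simp: bar_points_def bars.alive_def min_def split: if_splits)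
  qed
  then show thesis using that by (auto simp: bars.visible_def)
qed

text \<open>The count is applied to a modified configuration in which one long bar each replaces the
  bars of 1 and \<open>n\<close>. Thus only the bars of the \<open>n - 2\<close> inner vertices
  enter the bound.\<close>

lemma arcs_bound:
  assumes n: "3 \<le> n"
  shows "n * (n - 1) div 2 \<le> 3 * (t * (n - 2))"
proof -
  define M where "M = Sigma {2..n-1} f"
  have M_sub: "M \<subseteq> labelled_bars" unfolding M_def labelled_bars_def by auto
  have mem_M: "p \<in> M \<longleftrightarrow> fst p \<in> {2..n-1} \<and> snd p \<in> f (fst p)" for p
    by (cases p) (simp add: M_def)
  have fM: "finite M" using M_sub bars.fin finite_subset by blast
  define e where "e = (\<lambda>p. \<bar>bar_left p\<bar> + \<bar>bar_right p\<bar> + \<bar>bar_height p\<bar>)"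
  \<comment> \<open>\<open>K\<close> exceeds all coordinates of inner bars in absolute value; the
    summand 1 makes this strict and keeps \<open>K\<close> positive even for empty
    \<open>M\<close>.\<close>
  define K where "K = (\<Sum>p\<in>M. e (snd p)) + 1"
  have e_nonneg: "0 \<le> e a" for a by (simp add: e_def)
  have K: "- K < bar_left (snd p) \<and> bar_right (snd p) < K \<and>
      - K < bar_height (snd p) \<and> bar_height (snd p) < K" if "p \<in> M" for p
  proof -
    have "e (snd p) < K"
      using member_le_sum[OF that, of "\<lambda>p. e (snd p)"] fM e_nonneg unfolding K_def by simp
    then show ?thesis unfolding e_def by linarith
  qed
  have "K > 0" unfolding K_def using sum_nonneg[of M "\<lambda>p. e (snd p)"] e_nonneg by simp
  define s where "s = (1::nat, Bar (- K) (- K) K)"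
  define u where "u = (n, Bar K (- K) K)"
  define S where "S = insert s (insert u M)"
  have in_S: "s \<in> S" "u \<in> S" "M \<subseteq> S" by (auto simp: S_def)
  have notin: "s \<notin> M" "u \<notin> M" using n by (auto simp: s_def u_def M_def)
  interpret long: sweep S
    "\<lambda>p. bar_left (snd p)" "\<lambda>p. bar_right (snd p)" "\<lambda>p. bar_height (snd p)" fst
    by unfold_locales (use fM in \<open>simp add: S_def\<close>)
  have alive_M: "bars.alive x p" if "long.alive x p" "p \<in> M" for x p
    using that M_sub by (auto simp: bars.alive_def long.alive_def)
  have range: "fst p \<in> {2..n-1}" if "p \<in> M" for p using that by (simp add: mem_M)
  \<comment> \<open>Two inner bars inherit both properties from the original sweep. In the mixed
    cases \<open>K\<close> places \<open>s\<close> below and \<open>u\<close> above every inner bar,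
    whose label lies strictly between 1 and \<open>n\<close>.\<close>
  interpret long: sorted_sweep S
    "\<lambda>p. bar_left (snd p)" "\<lambda>p. bar_right (snd p)" "\<lambda>p. bar_height (snd p)" fst
  proof unfold_locales
    fix x p q assume pq: "long.alive x p" "long.alive x q" "bar_height (snd p) = bar_height (snd q)"
    then have "p \<in> S" "q \<in> S" by (auto simp: long.alive_def)
    then consider "p \<in> M" "q \<in> M" | "p \<in> {s, u}" "q \<in> {s, u}"
      | "p \<in> M" "q \<in> {s, u}" | "p \<in> {s, u}" "q \<in> M"
      unfolding S_def by blast
    then show "p = q"
    proof cases
      case 1
      then show ?thesis using alive_M pq bars.height_inj by blast
    qed (use K[of p] K[of q] pq(3) \<open>K > 0\<close> in \<open>auto simp: s_def u_def\<close>)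
  next
    fix x p q assume pq: "long.alive x p" "long.alive x q" "bar_height (snd p) < bar_height (snd q)"
    then have "p \<in> S" "q \<in> S" by (auto simp: long.alive_def)
    then consider "p \<in> M" "q \<in> M" | "p \<in> {s, u}" "q \<in> {s, u}"
      | "p \<in> M" "q \<in> {s, u}" | "p \<in> {s, u}" "q \<in> M"
      unfolding S_def by blast
    then show "fst p \<le> fst q"
    proof cases
      case 1
      then show ?thesis using alive_M pq bars.lab_mono by blast
    qed (use K[of p] K[of q] range[of p] range[of q] pq(3) \<open>K > 0\<close> n in \<open>auto simp: s_def u_def\<close>)
  qed
  have "\<exists>x. long.visible i j x" if ij: "1 \<le> i" "i < j" "j \<le> n" "(i, j) \<noteq> (1, n)" for i j
  proof -
    obtain x where "bars.visible i j x" using visible_bars ij(1-3) by blast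
    then obtain a b where ab: "bars.adj x a b" "fst a = i" "fst b = j"
      by (auto simp: bars.visible_def)
    then have alive: "bars.alive x a" "bars.alive x b"
      and less: "bar_height (snd a) < bar_height (snd b)"
      and none: "\<And>c. bars.alive x c \<Longrightarrow>
        \<not> (bar_height (snd a) < bar_height (snd c) \<and> bar_height (snd c) < bar_height (snd b))"
      by (auto simp: bars.adj_def)
    define a' where "a' = (if i = 1 then s else a)"
    define b' where "b' = (if j = n then u else b)"
    have M: "i \<noteq> 1 \<Longrightarrow> a \<in> M" "j \<noteq> n \<Longrightarrow> b \<in> M"
      using alive ab ij by (auto simp: bars.alive_def labelled_bars_iff mem_M)
    \<comment> \<open>At least one of the two bars is inner, so the line at \<open>x\<close> crosses
      both long bars.\<close>
    have "a \<in> M \<or> b \<in> M" using M ij by blast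
    then have x: "- K \<le> x" "x < K"
      using alive K[of a] K[of b] by (auto simp: bars.alive_def)
    have "long.alive x p" if "p \<in> M" "bars.alive x p" for p
      using that in_S unfolding long.alive_def bars.alive_def by blast
    moreover have "long.alive x s" "long.alive x u"
      using in_S x unfolding long.alive_def by (simp_all add: s_def u_def)
    ultimately have "long.alive x a'" "long.alive x b'"
      using alive M unfolding a'_def b'_def by presburger+
    moreover have "bar_height (snd a') < bar_height (snd b')"
      using K[of a] K[of b] M less ij by (auto simp: a'_def b'_def s_def u_def)
    moreover have "\<not> (bar_height (snd a') < bar_height (snd c) \<and> bar_height (snd c) < bar_height (snd b'))"
      if c: "long.alive x c" for c
    proof
      assume *: "bar_height (snd a') < bar_height (snd c) \<and> bar_height (snd c) < bar_height (snd b')"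
      have "c \<in> M"
      proof (rule ccontr)
        assume "c \<notin> M"
        moreover have "c \<in> S" using c by (simp add: long.alive_def)
        ultimately have "c = s \<or> c = u" by (simp add: S_def)
        then show False
          using * K[of a] K[of b] M \<open>K > 0\<close> by (auto simp: a'_def b'_def s_def u_def split: if_splits)
      qed
      then have cx: "bars.alive x c" and lab: "2 \<le> fst c" "fst c < n"
        using alive_M c range[of c] n by auto
      \<comment> \<open>When \<open>s\<close> replaces \<open>a\<close>, a bar of \<open>M\<close>
        below \<open>a\<close> might come to block. Sortedness excludes this, since \<open>a\<close>
        has label 1 and \<open>c\<close> a larger label. The upper end is symmetric.\<close>
      have "bar_height (snd a) < bar_height (snd c)"
      proof (cases "i = 1")
        case True
        have "\<not> fst c \<le> fst a" using lab True ab by simp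
        then show ?thesis
          using bars.lab_mono[OF cx alive(1)] bars.height_inj[OF cx alive(1)]
          by (metis linorder_neqE order_refl)
      qed (use * in \<open>simp add: a'_def\<close>)
      moreover have "bar_height (snd c) < bar_height (snd b)"
      proof (cases "j = n")
        case True
        have "\<not> fst b \<le> fst c" using lab True ab by simp
        then show ?thesis
          using bars.lab_mono[OF alive(2) cx] bars.height_inj[OF alive(2) cx]
          by (metis linorder_neqE order_refl)
      qed (use * in \<open>simp add: b'_def\<close>)
      ultimately show False using none[OF cx] by blast
    qed
    ultimately have "long.adj x a' b'" unfolding long.adj_def by blast
    moreover have "fst a' = i" "fst b' = j" using ab by (auto simp: a'_def b'_def s_def u_def)
    ultimately show ?thesis unfolding long.visible_def by blast
  qed
  then have "n * (n - 1) div 2 \<le> 3 * card M"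
    using n K range notin \<open>K > 0\<close>
    by (intro long.arcs_le_three_times_bars[of s u "- K" K])
      (fastforce simp: S_def s_def u_def)+
  moreover have "card M \<le> t * (n - 2)"
  proof -
    have "card M = (\<Sum>v \<in> {2..n-1}. card (f v))"
      unfolding M_def using finite_bars by (subst card_SigmaI) auto
    also have "\<dots> \<le> (\<Sum>v \<in> {2..n-1}. t)"
      using n by (intro sum_mono card_bars) auto
    also have "\<dots> = t * (n - 2)" using n by simp
    finally show ?thesis .
  qed
  ultimately show ?thesis by linarith
qed

end

subsection \<open>Layouts for the upper bounds\<close>

text \<open>The list \<open>I ! (v - 1)\<close> holds the intervals occupied by the bars of \<open>v\<close>.\<close>

type_synonym layout = "(nat \<times> nat) list list"

definition layout_bars :: "layout \<Rightarrow> nat \<Rightarrow> bar set" where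
  "layout_bars I v = (\<lambda>(a, b). Bar (real v) (real a) (real b)) ` set (I ! (v - 1))"

fun separated :: "(nat \<times> nat) list \<Rightarrow> bool" where
  "separated [] \<longleftrightarrow> True"
| "separated ((a, b) # ps) \<longleftrightarrow> a < b \<and> list_all (\<lambda>(c, d). b \<le> c) ps \<and> separated ps"

text \<open>The number \<open>x\<close> stands for the unit column from \<open>x\<close> to
  \<open>x + 1\<close>. All endpoints are integers, so an interval spans this column or misses its
  interior.\<close>

definition occupied :: "nat \<Rightarrow> (nat \<times> nat) list \<Rightarrow> bool" where
  "occupied x ps \<longleftrightarrow> list_ex (\<lambda>(a, b). a \<le> x \<and> x < b) ps"

text \<open>This is the row hit first when looking up column \<open>x\<close> from below all of
  \<open>I\<close>; the value is \<open>length I\<close> if the column is free.\<close>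

definition next_occupied :: "layout \<Rightarrow> nat \<Rightarrow> nat" where
  "next_occupied I x = length (takeWhile (\<lambda>ps. \<not> occupied x ps) I)"

text \<open>The completeness test is recursive and uses only finite lists, so that it can be
  evaluated: each row above \<open>ps\<close> must be hit first in some column spanned by
  \<open>ps\<close>.\<close>

fun complete_layout :: "layout \<Rightarrow> bool" where
  "complete_layout [] \<longleftrightarrow> True"
| "complete_layout (ps # I) \<longleftrightarrow>
     set [0..<length I] \<subseteq> set (map (next_occupied I) (concat (map (\<lambda>(a, b). [a..<b]) ps))) \<and>
     complete_layout I"

lemma separated_intervals:
  assumes "separated ps" "(a, b) \<in> set ps"
  shows "a < b"
  using assms by (induction ps rule: separated.induct) auto

lemma separated_disjoint:
  assumes "separated ps" "(a, b) \<in> set ps" "(c, d) \<in> set ps" "(a, b) \<noteq> (c, d)"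
  shows "b \<le> c \<or> d \<le> a"
  using assms by (induction ps rule: separated.induct) (auto simp: list_all_iff)

lemma complete_layoutD:
  assumes "complete_layout I" "i < j" "j < length I"
  shows "\<exists>x. occupied x (I ! i) \<and> occupied x (I ! j) \<and> (\<forall>m. i < m \<and> m < j \<longrightarrow> \<not> occupied x (I ! m))"
  using assms
proof (induction I arbitrary: i j)
  case (Cons ps I)
  then obtain j' where j: "j = Suc j'" by (cases j) auto
  show ?case
  proof (cases i)
    case 0
    have "j' < length I" using Cons.prems j by simp
    then have "j' \<in> set (map (next_occupied I) (concat (map (\<lambda>(a, b). [a..<b]) ps)))"
      using Cons.prems(1) by (auto simp del: set_map set_concat)
    then obtain x where x: "occupied x ps" "next_occupied I x = j'"
      by (fastforce simp: occupied_def list_ex_iff)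
    then have "occupied x (I ! j')"
      using nth_length_takeWhile[of "\<lambda>ps. \<not> occupied x ps" I] \<open>j' < length I\<close>
      by (simp add: next_occupied_def)
    moreover have "\<not> occupied x ((ps # I) ! m)" if m: "i < m" "m < j" for m
    proof -
      obtain k where k: "m = Suc k" "k < next_occupied I x"
        using m 0 j x by (cases m) auto
      then have "I ! k \<in> set (takeWhile (\<lambda>ps. \<not> occupied x ps) I)"
        unfolding next_occupied_def by (metis nth_mem takeWhile_nth)
      then show ?thesis using k(1) by (auto dest: set_takeWhileD)
    qed
    ultimately show ?thesis using x 0 j by auto
  next
    case (Suc i')
    then obtain x where x: "occupied x (I ! i')" "occupied x (I ! j')"
      "\<forall>m. i' < m \<and> m < j' \<longrightarrow> \<not> occupied x (I ! m)"
      using Cons.IH[of i' j'] Cons.prems j by auto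
    have "\<not> occupied x ((ps # I) ! m)" if "i < m" "m < j" for m
      using that x(3) Suc j by (cases m) auto
    then show ?thesis using x Suc j by auto
  qed
qed simp

text \<open>With the index as height, no bar sees one of a smaller index, and overlaps could only
  occur within a row. The visibilities themselves are unit columns supplied by completeness.\<close>

lemma layout_rep:
  assumes sep: "list_all separated I" and len: "list_all (\<lambda>ps. length ps \<le> t) I"
    and complete: "complete_layout I"
  shows "bar_visibility_rep (transitive_tournament (length I)) t (layout_bars I)"
  unfolding bar_visibility_rep_def transitive_tournament_dominates_iff
proof (intro conjI ballI impI)
  let ?n = "length I"
  have verts: "verts (transitive_tournament ?n) = {1..?n}"
    by (simp add: transitive_tournament_def)
  have mem: "I ! (v - 1) \<in> set I" if "v \<in> {1..?n}" for v using that by auto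
  have height: "bar_height a = real v" if "a \<in> layout_bars I v" for a v
    using that by (auto simp: layout_bars_def)
  fix x assume "x \<in> verts (transitive_tournament ?n)"
  then have x: "x \<in> {1..?n}" by (simp add: verts)
  show "finite (layout_bars I x)" by (simp add: layout_bars_def)
  have "card (layout_bars I x) \<le> length (I ! (x - 1))"
    unfolding layout_bars_def by (meson card_image_le card_length finite_set le_trans)
  then show "card (layout_bars I x) \<le> t"
    using mem[OF x] len by (auto simp: list_all_iff)
  show "proper_bar a" if "a \<in> layout_bars I x" for a
    using that mem[OF x] sep separated_intervals
    by (auto simp: layout_bars_def proper_bar_def list_all_iff)
  fix y assume "y \<in> verts (transitive_tournament ?n)"
  then have y: "y \<in> {1..?n}" by (simp add: verts)
  show "\<not> bars_overlap a b"
    if ab: "a \<in> layout_bars I x" "b \<in> layout_bars I y" "(x, a) \<noteq> (y, b)" for a b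
  proof
    assume overlap: "bars_overlap a b"
    then have "x = y" using height ab by (simp add: bars_overlap_def)
    obtain l r where a: "a = Bar x l r" "(l, r) \<in> set (I ! (x - 1))"
      using ab(1) by (auto simp: layout_bars_def)
    obtain l' r' where b: "b = Bar x l' r'" "(l', r') \<in> set (I ! (x - 1))"
      using ab(2) \<open>x = y\<close> by (auto simp: layout_bars_def)
    have "(l, r) \<noteq> (l', r')" using ab(3) \<open>x = y\<close> a b by auto
    then have "r \<le> l' \<or> r' \<le> l"
      using separated_disjoint[OF _ a(2) b(2)] mem[OF x] sep by (simp add: list_all_iff)
    then show False using overlap a b by (auto simp: bars_overlap_def)
  qed
  assume "x \<noteq> y"
  show "(x \<in> {1..?n} \<and> y \<in> {1..?n} \<and> x < y) \<longleftrightarrow> (\<exists>a \<in> layout_bars I x. \<exists>b \<in> layout_bars I y.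
    bar_sees (\<Union>v \<in> verts (transitive_tournament ?n). layout_bars I v) a b)"
  proof
    assume "\<exists>a \<in> layout_bars I x. \<exists>b \<in> layout_bars I y.
      bar_sees (\<Union>v \<in> verts (transitive_tournament ?n). layout_bars I v) a b"
    then show "x \<in> {1..?n} \<and> y \<in> {1..?n} \<and> x < y"
      using x y height by (fastforce simp: bar_sees_def)
  next
    assume "x \<in> {1..?n} \<and> y \<in> {1..?n} \<and> x < y"
    then have "x - 1 < y - 1" "y - 1 < ?n" by auto
    then obtain z where z: "occupied z (I ! (x - 1))" "occupied z (I ! (y - 1))"
      and free: "\<And>m. x - 1 < m \<Longrightarrow> m < y - 1 \<Longrightarrow> \<not> occupied z (I ! m)"
      using complete_layoutD[OF complete, of "x - 1" "y - 1"] by blast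
    obtain l r where lr: "(l, r) \<in> set (I ! (x - 1))" "l \<le> z" "z < r"
      using z(1) by (auto simp: occupied_def list_ex_iff)
    obtain l' r' where lr': "(l', r') \<in> set (I ! (y - 1))" "l' \<le> z" "z < r'"
      using z(2) by (auto simp: occupied_def list_ex_iff)
    define a where "a = Bar x l r"
    define b where "b = Bar y l' r'"
    have "a \<in> layout_bars I x" "b \<in> layout_bars I y"
      using lr lr' by (force simp: layout_bars_def a_def b_def)+
    moreover have "bar_points c \<inter> ({real z<..<real (z + 1)} \<times> {bar_height a..bar_height b}) = {}"
      if c: "c \<in> (\<Union>v \<in> {1..?n}. layout_bars I v) - {a, b}" for c
    proof (cases "bar_height a \<le> bar_height c \<and> bar_height c \<le> bar_height b")
      case True
      from c obtain v p q where v: "v \<in> {1..?n}" "(p, q) \<in> set (I ! (v - 1))" "c = Bar v p q"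
        by (auto simp: layout_bars_def)
      then have "x \<le> v" "v \<le> y" using True by (simp_all add: a_def b_def)
      then consider "v = x" | "v = y" | "x < v" "v < y" by linarith
      \<comment> \<open>By integrality, a bar that does not span column \<open>z\<close> stays
        outside the open strip. In the rows of \<open>x\<close> and \<open>y\<close> separation
        ensures this, in the rows between them the choice of \<open>z\<close>.\<close>
      then have "q \<le> z \<or> z + 1 \<le> p"
      proof cases
        case 1
        then have "(p, q) \<noteq> (l, r)" using c v by (auto simp: a_def)
        then have "q \<le> l \<or> r \<le> p"
          using separated_disjoint mem[OF x] sep lr(1) v(2) 1 by (simp add: list_all_iff) blast
        then show ?thesis using lr by auto
      next
        case 2
        then have "(p, q) \<noteq> (l', r')" using c v by (auto simp: b_def)
        then have "q \<le> l' \<or> r' \<le> p"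
          using separated_disjoint mem[OF y] sep lr'(1) v(2) 2 by (simp add: list_all_iff) blast
        then show ?thesis using lr' by auto
      next
        case 3
        then have "\<not> occupied z (I ! (v - 1))" using x by (intro free) auto
        then show ?thesis using v(2) by (force simp: occupied_def list_ex_iff)
      qed
      then show ?thesis using v(3) by (auto simp: bar_points_def)
    qed (auto simp: bar_points_def)
    ultimately show "\<exists>a \<in> layout_bars I x. \<exists>b \<in> layout_bars I y.
      bar_sees (\<Union>v \<in> verts (transitive_tournament ?n). layout_bars I v) a b"
      unfolding verts bar_sees_def
      using lr lr' \<open>x \<in> {1..?n} \<and> y \<in> {1..?n} \<and> x < y\<close>
      by (intro bexI[of _ a] bexI[of _ b] conjI exI[of _ "real z"] exI[of _ "real (z + 1)"])
        (auto simp: a_def b_def)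
  qed
qed

section \<open>The layouts for 11, 12 and 17 vertices and the exact values\<close>

text \<open>Both layouts were found by simulated annealing on the number of missing visibilities.\<close>

definition layout12 :: layout where
  "layout12 =
    [[(0, 36)],
     [(7, 12), (18, 20), (22, 36)],
     [(8, 14), (23, 25), (30, 34)],
     [(0, 3), (10, 13), (28, 31)],
     [(3, 5), (26, 30), (31, 32)],
     [(12, 16), (28, 29), (35, 36)],
     [(9, 11), (17, 19), (27, 29)],
     [(0, 1), (15, 18), (24, 27)],
     [(2, 4), (14, 21), (33, 34)],
     [(13, 17), (18, 25), (26, 31)],
     [(6, 7), (10, 12), (18, 36)],
     [(0, 36)]]"

definition layout17 :: layout where
  "layout17 =
    [[(0, 74)],
     [(5, 48), (53, 58), (66, 71)],
     [(3, 25), (31, 38), (41, 44), (54, 56)],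
     [(17, 26), (28, 33), (45, 47), (59, 62)],
     [(2, 9), (15, 22), (56, 57), (69, 71)],
     [(2, 5), (28, 30), (35, 39), (49, 52)],
     [(10, 13), (18, 24), (37, 40), (71, 73)],
     [(8, 12), (25, 26), (36, 39), (65, 67)],
     [(9, 11), (14, 16), (21, 23), (46, 50)],
     [(15, 17), (29, 31), (38, 42), (58, 59)],
     [(1, 3), (37, 40), (43, 49), (70, 72)],
     [(4, 6), (22, 27), (41, 47), (63, 64)],
     [(20, 27), (34, 42), (61, 63), (68, 70)],
     [(7, 10), (23, 30), (32, 47), (71, 74)],
     [(5, 13), (23, 34), (51, 55), (69, 71)],
     [(19, 24), (27, 60), (63, 66)],
     [(0, 74)]]"

text \<open>Deleting the top row of the layout for 12 vertices leaves one for 11, because a top bar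
  never lies between two lower ones.\<close>

lemma layout11_rep: "bar_visibility_rep (transitive_tournament 11) 3 (layout_bars (take 11 layout12))"
  and layout12_rep: "bar_visibility_rep (transitive_tournament 12) 3 (layout_bars layout12)"
  and layout17_rep: "bar_visibility_rep (transitive_tournament 17) 4 (layout_bars layout17)"
proof -
  have "length (take 11 layout12) = 11" "length layout12 = 12" "length layout17 = 17"
    by (simp_all add: layout12_def layout17_def)
  moreover have "list_all separated (take 11 layout12)" "list_all separated layout12"
      "list_all separated layout17" "list_all (\<lambda>ps. length ps \<le> 3) (take 11 layout12)"
      "list_all (\<lambda>ps. length ps \<le> 3) layout12" "list_all (\<lambda>ps. length ps \<le> 4) layout17"
    by code_simp+
  moreover have "complete_layout (take 11 layout12)" "complete_layout layout12"
      "complete_layout layout17"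
    by code_simp+
  ultimately show "bar_visibility_rep (transitive_tournament 11) 3 (layout_bars (take 11 layout12))"
    "bar_visibility_rep (transitive_tournament 12) 3 (layout_bars layout12)"
    "bar_visibility_rep (transitive_tournament 17) 4 (layout_bars layout17)"
    using layout_rep by metis+
qed

text \<open>The strict inequality says that \<open>t - 1\<close> bars per vertex violate the
  counting bound, so any representation needs at least \<open>t\<close>.\<close>

lemma bar_visibility_number_transitive_tournament:
  assumes "bar_visibility_rep (transitive_tournament n) t f"
    and "3 \<le> n" "3 * ((t - 1) * (n - 2)) < n * (n - 1) div 2"
  shows "bar_visibility_number (transitive_tournament n) = t"
  unfolding bar_visibility_number_def
proof (rule Least_equality)
  fix t' assume "\<exists>f. bar_visibility_rep (transitive_tournament n) t' f"
  then have "n * (n - 1) div 2 \<le> 3 * (t' * (n - 2))"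
    using tournament_rep.arcs_bound \<open>3 \<le> n\<close> by (auto simp: tournament_rep_def)
  then have "(t - 1) * (n - 2) < t' * (n - 2)" using assms(3) by linarith
  then have "t - 1 < t'" by simp
  then show "t \<le> t'" by linarith
qed (use assms(1) in blast)

theorem corollary3p6:
  shows "bar_visibility_number (transitive_tournament 11) = 3
       \<and> bar_visibility_number (transitive_tournament 12) = 3
       \<and> bar_visibility_number (transitive_tournament 17) = 4"
  \<comment> \<open>The numerical conditions are 54 < 55, 60 < 66 and 135 < 136 for 11, 12 and 17
    vertices.\<close>
  using layout11_rep layout12_rep layout17_rep
  by (intro conjI) (auto intro!: bar_visibility_number_transitive_tournament)

end
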